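(* Let $G_\bullet/\Gamma$ be a nilmanifold (of some finite length). Then $\mathrm{poly}(\mathscr F_\emptyset\to G_\bullet/\Gamma)$ is compact in the topology of pointwise convergence, i.e. as a subspace of the product space $(G/\Gamma)^{\mathscr F_\emptyset}$.
   Context: $\mathscr F$ is the family of finite non-empty subsets of $\mathbb N=\{1,2,\dots\}$ and $\mathscr F_\emptyset=\mathscr F\cup\{\emptyset\}$. A (Lie) prefiltration $G_\bullet$ on a nilpotent Lie group $G$ is a descending sequence of Lie subgroups $G=G_0\supseteq G_1\supseteq G_2\supseteq\cdots$ with $[G_i,G_j]\subseteq G_{i+j}$ for all $i,j$ and $G_{d+1}=\{e\}$ for some $d$; the least such $d$ is its length. It is a filtration if moreover $G_0=G_1=G$. $G_{\bullet+1}$ denotes the prefiltration $i\mapsto G_{i+1}$ (on the group $G_1$). If $\Gamma<G$ is a discrete cocompact subgroup and $G_i\cap\Gamma$ is cocompact in $G_i$ for each $i$, we call $G_\bullet/\Gamma$ a nilmanifold of length $d$ (the length of the filtration). A map $g:\mathscr F_\emptyset\to G$ is polynomial with respect to a prefiltration $G_\bullet$, written $g\in\mathrm{poly}(\mathscr F_\emptyset\to G_\bullet)$, if either $G_0=\{e\}$ and $g\equiv e$, or for every $\beta\in\mathscr F_\emptyset$ there is $D_\beta g\in\mathrm{poly}(\mathscr F_\emptyset\to G_{\bullet+1})$ with $D_\beta g(\alpha)=g(\alpha)^{-1}g(\alpha\cup\beta)$ for all $\alpha\in\mathscr F_\emptyset$ disjoint from $\beta$ (a recursive definition, terminating since the prefiltration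 has finite length). $\mathrm{poly}(\mathscr F_\emptyset\to G_\bullet/\Gamma)$ denotes the set of maps $\alpha\mapsto g(\alpha)\Gamma$ with $g\in\mathrm{poly}(\mathscr F_\emptyset\to G_\bullet)$. *)

theory Defs
  imports "HOL-Analysis.Analysis" "HOL-Algebra.Coset"
begin

text \<open>The index set F_empty: finite subsets of N = {1,2,...} (including the empty set).\<close>
definition Fe :: "nat set set" where
  "Fe = {\<alpha>. finite \<alpha> \<and> 0 \<notin> \<alpha>}"

definition topological_group :: "('g, 'b) monoid_scheme \<Rightarrow> 'g topology \<Rightarrow> bool" where
  "topological_group G T \<longleftrightarrow> group G \<and> topspace T = carrier G \<and>
     continuous_map (prod_topology T T) T (\<lambda>(x, y). x \<otimes>\<^bsub>G\<^esub> y) \<and>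
     continuous_map T T (\<lambda>x. inv\<^bsub>G\<^esub> x)"

definition coset_space :: "('g, 'b) monoid_scheme \<Rightarrow> 'g set \<Rightarrow> 'g set \<Rightarrow> 'g set set" where
  "coset_space G H K = {h <#\<^bsub>G\<^esub> K | h. h \<in> H}"

definition quotient_top ::
  "('g, 'b) monoid_scheme \<Rightarrow> 'g topology \<Rightarrow> 'g set \<Rightarrow> 'g set \<Rightarrow> 'g set topology" where
  "quotient_top G T H K = topology (\<lambda>U. U \<subseteq> coset_space G H K \<and>
      openin (subtopology T H) (H \<inter> \<Union>U))"

definition cocompact :: "('g, 'b) monoid_scheme \<Rightarrow> 'g topology \<Rightarrow> 'g set \<Rightarrow> 'g set \<Rightarrow> bool" where
  "cocompact G T H K \<longleftrightarrow> compact_space (quotient_top G T H K)"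

definition commutator :: "('g, 'b) monoid_scheme \<Rightarrow> 'g \<Rightarrow> 'g \<Rightarrow> 'g" where
  "commutator G x y = inv\<^bsub>G\<^esub> x \<otimes>\<^bsub>G\<^esub> inv\<^bsub>G\<^esub> y \<otimes>\<^bsub>G\<^esub> x \<otimes>\<^bsub>G\<^esub> y"

text \<open>Prefiltration (on the group with carrier Gs 0): descending chain of subgroups with
  [G_i, G_j] contained in G_(i+j), eventually trivial. Lie subgroups are rendered as
  closed subgroups.\<close>
definition prefiltration ::
  "('g, 'b) monoid_scheme \<Rightarrow> 'g topology \<Rightarrow> (nat \<Rightarrow> 'g set) \<Rightarrow> bool" where
  "prefiltration G T Gs \<longleftrightarrow>
     (\<forall>i. subgroup (Gs i) G \<and> closedin T (Gs i) \<and> Gs (Suc i) \<subseteq> Gs i) \<and>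
     (\<forall>i j x y. x \<in> Gs i \<longrightarrow> y \<in> Gs j \<longrightarrow> commutator G x y \<in> Gs (i + j)) \<and>
     (\<exists>d. Gs (Suc d) = {\<one>\<^bsub>G\<^esub>})"

definition filtration ::
  "('g, 'b) monoid_scheme \<Rightarrow> 'g topology \<Rightarrow> (nat \<Rightarrow> 'g set) \<Rightarrow> bool" where
  "filtration G T Gs \<longleftrightarrow> prefiltration G T Gs \<and> Gs 0 = carrier G \<and> Gs 1 = carrier G"

text \<open>Polynomial maps F_empty -> G_bullet, via the recursive definition with a fuel
  parameter n bounding the recursion depth (the recursion in the paper terminates
  because the prefiltration has finite length).\<close>
fun poly_fuel :: "('g, 'b) monoid_scheme \<Rightarrow> nat \<Rightarrow> (nat \<Rightarrow> 'g set) \<Rightarrow> (nat set \<Rightarrow> 'g) \<Rightarrow> bool" where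
  "poly_fuel G 0 Gs g \<longleftrightarrow> Gs 0 = {\<one>\<^bsub>G\<^esub>} \<and> (\<forall>\<alpha>\<in>Fe. g \<alpha> = \<one>\<^bsub>G\<^esub>)"
| "poly_fuel G (Suc n) Gs g \<longleftrightarrow>
     (Gs 0 = {\<one>\<^bsub>G\<^esub>} \<and> (\<forall>\<alpha>\<in>Fe. g \<alpha> = \<one>\<^bsub>G\<^esub>)) \<or>
     ((\<forall>\<alpha>\<in>Fe. g \<alpha> \<in> Gs 0) \<and>
      (\<forall>\<beta>\<in>Fe. \<exists>h. poly_fuel G n (\<lambda>i. Gs (Suc i)) h \<and>
         (\<forall>\<alpha>\<in>Fe. \<alpha> \<inter> \<beta> = {} \<longrightarrow> h \<alpha> = inv\<^bsub>G\<^esub> (g \<alpha>) \<otimes>\<^bsub>G\<^esub> g (\<alpha> \<union> \<beta>))))"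

definition poly_map :: "('g, 'b) monoid_scheme \<Rightarrow> (nat \<Rightarrow> 'g set) \<Rightarrow> (nat set \<Rightarrow> 'g) \<Rightarrow> bool" where
  "poly_map G Gs g \<longleftrightarrow> (\<exists>n. poly_fuel G n Gs g)"

text \<open>poly(F_empty -> G_bullet / Gamma), as elements of the product space (G/Gamma)^F_empty
  (functions restricted to Fe, as in product_topology).\<close>
definition poly_quot ::
  "('g, 'b) monoid_scheme \<Rightarrow> (nat \<Rightarrow> 'g set) \<Rightarrow> 'g set \<Rightarrow> (nat set \<Rightarrow> 'g set) set" where
  "poly_quot G Gs \<Gamma> = {(\<lambda>\<alpha>\<in>Fe. g \<alpha> <#\<^bsub>G\<^esub> \<Gamma>) | g. poly_map G Gs g}"

end

theory Submission
  imports Defs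
begin

text \<open>Being polynomial means that every iterated derivative of order \<open>k\<close> takes values in the closed
  subgroup \<open>Gs k\<close>, so the polynomial maps form a closed set of functions. The value
  \<open>g \<beta>\<close> of a polynomial is determined by the values on proper subsets of \<open>\<beta>\<close> up to an element of
  \<open>Gs (card \<beta>)\<close>, which cocompactness brings into a compact set after right multiplication by some
  \<open>c \<in> \<Gamma>\<close>. The map equal to \<open>c\<close> above \<open>\<beta>\<close> and trivial elsewhere is polynomial, and polynomials
  are closed under products (Leibman), so multiplying by it alters \<open>g \<beta>\<close> without leaving the coset
  class. Correcting the finite sets one after the other, every polynomial is modulo \<open>\<Gamma>\<close> equal to one
  in a fixed product of compact sets, and Tychonoff's theorem applies.\<close>

section \<open>Index sets and commutator identities\<close>

lemma Fe_Un: "\<alpha> \<in> Fe \<Longrightarrow> \<beta> \<in> Fe \<Longrightarrow> \<alpha> \<union> \<beta> \<in> Fe"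
  by (auto simp: Fe_def)

lemma Fe_subset: "\<alpha> \<in> Fe \<Longrightarrow> \<beta> \<subseteq> \<alpha> \<Longrightarrow> \<beta> \<in> Fe"
  by (auto simp: Fe_def intro: finite_subset)

lemma Fe_Diff: "\<alpha> \<in> Fe \<Longrightarrow> \<alpha> - S \<in> Fe"
  by (auto simp: Fe_def)

context group
begin

lemma cancel_inv_left:
  assumes "x \<in> carrier G" "y \<in> carrier G"
  shows "inv x \<otimes> (x \<otimes> y) = y" "x \<otimes> (inv x \<otimes> y) = y"
  using assms by (simp_all add: m_assoc [symmetric])

lemma commutator_closed [simp]:
  "x \<in> carrier G \<Longrightarrow> y \<in> carrier G \<Longrightarrow> commutator G x y \<in> carrier G"
  by (simp add: commutator_def)

text \<open>Product rule: \<open>a\<close>, \<open>b\<close> stand for the values of two maps at a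
  point and \<open>x\<close>, \<open>y\<close> for their derivatives there. After cancelling
  \<open>a\<close>, moving \<open>x\<close> past \<open>b\<close> costs a commutator, because
  \<open>inv b \<otimes> x \<otimes> b = x \<otimes> commutator G x b\<close>.\<close>

lemma diff_mult_eq:
  assumes "a \<in> carrier G" "b \<in> carrier G" "x \<in> carrier G" "y \<in> carrier G"
  shows "inv (a \<otimes> b) \<otimes> ((a \<otimes> x) \<otimes> (b \<otimes> y)) = x \<otimes> commutator G x b \<otimes> y"
  using assms by (simp add: commutator_def m_assoc inv_mult_group cancel_inv_left)

text \<open>Commutator rule in the same notation. It follows from [a x, z] = [a, z] [[a, z], x]
  [x, z] and [a, b y] = [a, y] [a, b] [[a, b], y]. The shape is what counts: each of the five
  factors is a commutator involving the derivative \<open>x\<close> or \<open>y\<close>, and so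
  gains one level of the filtration.\<close>

lemma diff_commutator_eq:
  assumes "a \<in> carrier G" "b \<in> carrier G" "x \<in> carrier G" "y \<in> carrier G"
  shows "inv (commutator G a b) \<otimes> commutator G (a \<otimes> x) (b \<otimes> y) =
    commutator G a y \<otimes> commutator G (commutator G a y) (commutator G a b)
     \<otimes> commutator G (commutator G a b) y \<otimes> commutator G (commutator G a (b \<otimes> y)) x
     \<otimes> commutator G x (b \<otimes> y)"
  using assms by (simp add: commutator_def m_assoc inv_mult_group cancel_inv_left)

end

section \<open>Filtered groups and iterated derivatives\<close>

locale filtered_group = group G for G (structure) +
  fixes Gs :: "nat \<Rightarrow> 'a set"
  assumes Gs_subgroup: "subgroup (Gs i) G"
    and Gs_Suc: "Gs (Suc i) \<subseteq> Gs i"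
    and Gs_commutator: "x \<in> Gs i \<Longrightarrow> y \<in> Gs j \<Longrightarrow> commutator G x y \<in> Gs (i + j)"
begin

lemma Gs_carrier: "x \<in> Gs i \<Longrightarrow> x \<in> carrier G"
  using Gs_subgroup subgroup.mem_carrier by metis

lemma Gs_antimono: "i \<le> j \<Longrightarrow> Gs j \<subseteq> Gs i"
  using Gs_Suc by (simp add: lift_Suc_antimono_le)

lemma Gs_le: "x \<in> Gs j \<Longrightarrow> i \<le> j \<Longrightarrow> x \<in> Gs i"
  using Gs_antimono by blast

lemma Gs_one: "\<one> \<in> Gs i"
  by (simp add: Gs_subgroup subgroup.one_closed)

lemma Gs_mult: "x \<in> Gs i \<Longrightarrow> y \<in> Gs i \<Longrightarrow> x \<otimes> y \<in> Gs i"
  by (simp add: Gs_subgroup subgroup.m_closed)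

definition deriv_map :: "nat set \<Rightarrow> (nat set \<Rightarrow> 'a) \<Rightarrow> nat set \<Rightarrow> 'a" where
  "deriv_map \<beta> g \<alpha> = inv (g \<alpha>) \<otimes> g (\<alpha> \<union> \<beta>)"

text \<open>Only arguments disjoint from \<open>S\<close> matter: \<open>S\<close> collects the directions of the derivatives already
  taken. This replaces the choice of a polynomial extension of \<open>D\<^sub>\<beta> g\<close> in the definition.\<close>

primrec poly_upto :: "nat \<Rightarrow> nat set \<Rightarrow> nat \<Rightarrow> (nat set \<Rightarrow> 'a) \<Rightarrow> bool" where
  "poly_upto 0 S t g \<longleftrightarrow> (\<forall>\<alpha>\<in>Fe. \<alpha> \<inter> S = {} \<longrightarrow> g \<alpha> \<in> Gs t)"
| "poly_upto (Suc n) S t g \<longleftrightarrow> (\<forall>\<alpha>\<in>Fe. \<alpha> \<inter> S = {} \<longrightarrow> g \<alpha> \<in> Gs t) \<and>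
     (\<forall>\<beta>\<in>Fe. \<beta> \<inter> S = {} \<longrightarrow> poly_upto n (S \<union> \<beta>) (Suc t) (deriv_map \<beta> g))"

lemma poly_upto_value:
  "poly_upto n S t g \<Longrightarrow> \<alpha> \<in> Fe \<Longrightarrow> \<alpha> \<inter> S = {} \<Longrightarrow> g \<alpha> \<in> Gs t"
  by (cases n) auto

text \<open>Along directions disjoint from \<open>S\<close>, derivatives evaluate a map at arguments
  disjoint from \<open>S\<close> only. Hence a derivative may be rewritten by an identity that is
  valid just on such arguments.\<close>

lemma poly_upto_cong_imp:
  assumes "poly_upto n S t g" "\<And>\<alpha>. \<alpha> \<in> Fe \<Longrightarrow> \<alpha> \<inter> S = {} \<Longrightarrow> g \<alpha> = h \<alpha>"
  shows "poly_upto n S t h"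
  using assms
proof (induction n arbitrary: S t g h)
  case 0
  then show ?case by auto
next
  case (Suc n)
  have "poly_upto n (S \<union> \<beta>) (Suc t) (deriv_map \<beta> h)" if "\<beta> \<in> Fe" "\<beta> \<inter> S = {}" for \<beta>
  proof (rule Suc.IH)
    show "poly_upto n (S \<union> \<beta>) (Suc t) (deriv_map \<beta> g)"
      using Suc.prems that by simp
    show "deriv_map \<beta> g \<alpha> = deriv_map \<beta> h \<alpha>"
      if "\<alpha> \<in> Fe" "\<alpha> \<inter> (S \<union> \<beta>) = {}" for \<alpha>
    proof -
      have "\<alpha> \<union> \<beta> \<in> Fe" "(\<alpha> \<union> \<beta>) \<inter> S = {}" "\<alpha> \<inter> S = {}"
        using that \<open>\<beta> \<in> Fe\<close> \<open>\<beta> \<inter> S = {}\<close> Fe_Un by auto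
      then show ?thesis
        using Suc.prems(2) that by (simp add: deriv_map_def)
    qed
  qed
  then show ?case
    using Suc.prems by auto
qed

lemma poly_upto_cong:
  assumes "\<And>\<alpha>. \<alpha> \<in> Fe \<Longrightarrow> \<alpha> \<inter> S = {} \<Longrightarrow> g \<alpha> = h \<alpha>"
  shows "poly_upto n S t g \<longleftrightarrow> poly_upto n S t h"
  using assms poly_upto_cong_imp by metis

text \<open>Used to bring a map and its derivatives to a common order, excluded set and level, so
  that they can be combined in one product.\<close>

lemma poly_upto_mono:
  assumes "poly_upto n S t g" "m \<le> n" "S \<subseteq> S'" "t' \<le> t"
  shows "poly_upto m S' t' g"
  using assms
proof (induction m arbitrary: n S S' t t' g)
  case 0
  then show ?case
    using poly_upto_value Gs_le by (metis disjoint_iff poly_upto.simps(1) subset_iff)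
next
  case (Suc m)
  then obtain k where k: "n = Suc k" "m \<le> k"
    by (metis Suc_le_D Suc_le_mono)
  have "g \<alpha> \<in> Gs t'" if "\<alpha> \<in> Fe" "\<alpha> \<inter> S' = {}" for \<alpha>
    using that poly_upto_value[OF Suc.prems(1)] Gs_le Suc.prems by (metis disjoint_iff subset_iff)
  moreover have "poly_upto m (S' \<union> \<beta>) (Suc t') (deriv_map \<beta> g)"
    if "\<beta> \<in> Fe" "\<beta> \<inter> S' = {}" for \<beta>
  proof (rule Suc.IH)
    show "poly_upto k (S \<union> \<beta>) (Suc t) (deriv_map \<beta> g)"
      using Suc.prems(1,3) that k by (simp add: disjoint_iff subset_iff) blast
  qed (use k Suc.prems in auto)
  ultimately show ?case by simp
qed

section \<open>Closure under products, and maps supported above a set\<close>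

lemma poly_upto_one: "poly_upto n S t (\<lambda>_. \<one>)"
proof (induction n arbitrary: S t)
  case (Suc n)
  have "deriv_map \<beta> (\<lambda>_. \<one>) = (\<lambda>_. \<one>)" for \<beta>
    by (rule ext) (simp add: deriv_map_def)
  then show ?case using Suc Gs_one by simp
qed (simp add: Gs_one)

text \<open>Products and commutators have to be treated simultaneously, as the derivative of either one
  involves both.\<close>

lemma poly_upto_mult_commutator:
  "(\<forall>S t g h. poly_upto n S t g \<longrightarrow> poly_upto n S t h \<longrightarrow> poly_upto n S t (\<lambda>\<alpha>. g \<alpha> \<otimes> h \<alpha>)) \<and>
   (\<forall>S s t g h. poly_upto n S s g \<longrightarrow> poly_upto n S t h \<longrightarrow>
      poly_upto n S (s + t) (\<lambda>\<alpha>. commutator G (g \<alpha>) (h \<alpha>)))"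
proof (induction n)
  case 0
  then show ?case
    by (simp add: Gs_mult Gs_commutator)
next
  case (Suc n)
  have mult: "poly_upto n S t (\<lambda>\<alpha>. g \<alpha> \<otimes> h \<alpha>)"
    if "poly_upto n S t g" "poly_upto n S t h" for S t g h
    using Suc that by blast
  \<comment> \<open>The slack \<open>u \<le> s + t\<close> allows factors lying deeper than
    necessary to be used at one common level.\<close>
  have comm: "poly_upto n S u (\<lambda>\<alpha>. commutator G (g \<alpha>) (h \<alpha>))"
    if "poly_upto n S s g" "poly_upto n S t h" "u \<le> s + t" for S s t u g h
  proof (rule poly_upto_mono)
    show "poly_upto n S (s + t) (\<lambda>\<alpha>. commutator G (g \<alpha>) (h \<alpha>))"
      using Suc that by blast
  qed (use that in auto)
  have restr: "poly_upto n (S \<union> \<beta>) t g" if "poly_upto (Suc n) S t g" for S t \<beta> g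
    using that by (rule poly_upto_mono) auto
  have vals: "g \<alpha> \<in> carrier G" "deriv_map \<beta> g \<alpha> \<in> carrier G"
      "g (\<alpha> \<union> \<beta>) = g \<alpha> \<otimes> deriv_map \<beta> g \<alpha>"
    if "poly_upto (Suc n) S t g" "\<alpha> \<in> Fe" "\<beta> \<in> Fe" "\<alpha> \<inter> (S \<union> \<beta>) = {}" "\<beta> \<inter> S = {}" for S t \<alpha> \<beta> g
  proof -
    have "\<alpha> \<union> \<beta> \<in> Fe" "(\<alpha> \<union> \<beta>) \<inter> S = {}" "\<alpha> \<inter> S = {}"
      using that Fe_Un by auto
    then have "g \<alpha> \<in> carrier G" "g (\<alpha> \<union> \<beta>) \<in> carrier G"
      using poly_upto_value[OF that(1)] Gs_carrier that(2) by blast+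
    then show "g \<alpha> \<in> carrier G" "deriv_map \<beta> g \<alpha> \<in> carrier G"
      "g (\<alpha> \<union> \<beta>) = g \<alpha> \<otimes> deriv_map \<beta> g \<alpha>"
      by (simp_all add: deriv_map_def cancel_inv_left)
  qed
  have "poly_upto (Suc n) S t (\<lambda>\<alpha>. g \<alpha> \<otimes> h \<alpha>)"
    if g: "poly_upto (Suc n) S t g" and h: "poly_upto (Suc n) S t h" for S t g h
  proof -
    have "poly_upto n (S \<union> \<beta>) (Suc t) (deriv_map \<beta> (\<lambda>\<alpha>. g \<alpha> \<otimes> h \<alpha>))"
      if \<beta>: "\<beta> \<in> Fe" "\<beta> \<inter> S = {}" for \<beta>
    proof (rule poly_upto_cong_imp)
      let ?x = "deriv_map \<beta> g" and ?y = "deriv_map \<beta> h"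
      have x: "poly_upto n (S \<union> \<beta>) (Suc t) ?x" and y: "poly_upto n (S \<union> \<beta>) (Suc t) ?y"
        using g h \<beta> by auto
      \<comment> \<open>The levels of the entries add up to \<open>Suc t + t\<close>, which is at
        least \<open>Suc t\<close>.\<close>
      have "poly_upto n (S \<union> \<beta>) (Suc t) (\<lambda>\<alpha>. commutator G (?x \<alpha>) (h \<alpha>))"
        by (rule comm[OF x restr[OF h]]) simp
      then show "poly_upto n (S \<union> \<beta>) (Suc t)
          (\<lambda>\<alpha>. ?x \<alpha> \<otimes> commutator G (?x \<alpha>) (h \<alpha>) \<otimes> ?y \<alpha>)"
        by (intro mult x y)
      show "?x \<alpha> \<otimes> commutator G (?x \<alpha>) (h \<alpha>) \<otimes> ?y \<alpha> = deriv_map \<beta> (\<lambda>\<alpha>. g \<alpha> \<otimes> h \<alpha>) \<alpha>"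
        if "\<alpha> \<in> Fe" "\<alpha> \<inter> (S \<union> \<beta>) = {}" for \<alpha>
        using vals[OF g that(1) \<beta>(1) that(2) \<beta>(2)] vals[OF h that(1) \<beta>(1) that(2) \<beta>(2)]
        by (simp add: diff_mult_eq deriv_map_def[of _ "\<lambda>\<alpha>. g \<alpha> \<otimes> h \<alpha>"])
    qed
    then show ?thesis
      using poly_upto_value[OF g] poly_upto_value[OF h] Gs_mult by simp
  qed
  moreover have "poly_upto (Suc n) S (s + t) (\<lambda>\<alpha>. commutator G (g \<alpha>) (h \<alpha>))"
    if g: "poly_upto (Suc n) S s g" and h: "poly_upto (Suc n) S t h" for S s t g h
  proof -
    let ?c = "\<lambda>\<alpha>. commutator G (g \<alpha>) (h \<alpha>)"
    have "poly_upto n (S \<union> \<beta>) (Suc (s + t)) (deriv_map \<beta> ?c)"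
      if \<beta>: "\<beta> \<in> Fe" "\<beta> \<inter> S = {}" for \<beta>
    proof (rule poly_upto_cong_imp)
      let ?x = "deriv_map \<beta> g" and ?y = "deriv_map \<beta> h"
      have x: "poly_upto n (S \<union> \<beta>) (Suc s) ?x" and y: "poly_upto n (S \<union> \<beta>) (Suc t) ?y"
        using g h \<beta> by auto
      have g': "poly_upto n (S \<union> \<beta>) s g" and h': "poly_upto n (S \<union> \<beta>) t h"
        using restr g h by auto
      \<comment> \<open>On the relevant arguments this product is the shifted value
        \<open>h (\<alpha> \<union> \<beta>)\<close>.\<close>
      have hy: "poly_upto n (S \<union> \<beta>) t (\<lambda>\<alpha>. h \<alpha> \<otimes> ?y \<alpha>)"
        by (rule mult[OF h' poly_upto_mono[OF y]]) auto
      note c = comm[OF g' h' le_refl]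
      \<comment> \<open>In order, the five factors have levels s+t+1, 2s+2t+1, s+2t+1, 2s+t+1 and
        s+t+1, so each reaches \<open>Suc (s + t)\<close>.\<close>
      show "poly_upto n (S \<union> \<beta>) (Suc (s + t))
          (\<lambda>\<alpha>. commutator G (g \<alpha>) (?y \<alpha>) \<otimes> commutator G (commutator G (g \<alpha>) (?y \<alpha>)) (?c \<alpha>)
             \<otimes> commutator G (?c \<alpha>) (?y \<alpha>)
             \<otimes> commutator G (commutator G (g \<alpha>) (h \<alpha> \<otimes> ?y \<alpha>)) (?x \<alpha>)
             \<otimes> commutator G (?x \<alpha>) (h \<alpha> \<otimes> ?y \<alpha>))"
        by (intro mult comm[OF g' y] comm[OF comm[OF g' y le_refl] c] comm[OF c y]
              comm[OF comm[OF g' hy le_refl] x] comm[OF x hy]) auto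
      show "commutator G (g \<alpha>) (?y \<alpha>) \<otimes> commutator G (commutator G (g \<alpha>) (?y \<alpha>)) (?c \<alpha>)
             \<otimes> commutator G (?c \<alpha>) (?y \<alpha>)
             \<otimes> commutator G (commutator G (g \<alpha>) (h \<alpha> \<otimes> ?y \<alpha>)) (?x \<alpha>)
             \<otimes> commutator G (?x \<alpha>) (h \<alpha> \<otimes> ?y \<alpha>) = deriv_map \<beta> ?c \<alpha>"
        if "\<alpha> \<in> Fe" "\<alpha> \<inter> (S \<union> \<beta>) = {}" for \<alpha>
        using vals[OF g that(1) \<beta>(1) that(2) \<beta>(2)] vals[OF h that(1) \<beta>(1) that(2) \<beta>(2)]
        by (simp add: diff_commutator_eq deriv_map_def[of _ ?c])
    qed
    then show ?thesis
      using poly_upto_value[OF g] poly_upto_value[OF h] Gs_commutator by simp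
  qed
  ultimately show ?case by blast
qed

lemma poly_upto_mult:
  "poly_upto n S t g \<Longrightarrow> poly_upto n S t h \<Longrightarrow> poly_upto n S t (\<lambda>\<alpha>. g \<alpha> \<otimes> h \<alpha>)"
  using poly_upto_mult_commutator by blast

text \<open>A derivative along \<delta> is trivial if \<delta> misses \<open>\<beta>\<close>.
  Otherwise, on arguments disjoint from \<delta>, it is the same kind of map with
  \<open>\<beta>\<close> replaced by \<beta> - \<delta>: the gain of one level is paid for by at
  least one element of \<open>\<beta>\<close>.\<close>

lemma poly_upto_face:
  assumes "finite \<beta>" "c \<in> Gs (t + card \<beta>)"
  shows "poly_upto n S t (\<lambda>\<alpha>. if \<beta> \<subseteq> \<alpha> then c else \<one>)"
  using assms
proof (induction n arbitrary: S t \<beta>)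
  case 0
  then show ?case by (auto simp: Gs_one intro: Gs_le)
next
  case (Suc n)
  let ?f = "\<lambda>\<beta> \<alpha>. if \<beta> \<subseteq> \<alpha> then c else \<one>"
  have c: "c \<in> carrier G"
    using Suc.prems Gs_carrier by blast
  have "poly_upto n (S \<union> \<delta>) (Suc t) (deriv_map \<delta> (?f \<beta>))" for \<delta>
  proof (cases "\<beta> \<inter> \<delta> = {}")
    case True
    show ?thesis
    proof (rule poly_upto_cong_imp[OF poly_upto_one])
      fix \<alpha> :: "nat set"
      have "\<beta> \<subseteq> \<alpha> \<union> \<delta> \<longleftrightarrow> \<beta> \<subseteq> \<alpha>"
        using True by blast
      then show "\<one> = deriv_map \<delta> (?f \<beta>) \<alpha>"
        using c by (simp add: deriv_map_def)
    qed
  next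
    case False
    show ?thesis
    proof (rule poly_upto_cong_imp[OF Suc.IH])
      show "finite (\<beta> - \<delta>)"
        using Suc.prems by simp
      have "card (\<beta> - \<delta>) < card \<beta>"
        using False Suc.prems by (intro psubset_card_mono) auto
      then show "c \<in> Gs (Suc t + card (\<beta> - \<delta>))"
        using Suc.prems Gs_le by auto
      show "?f (\<beta> - \<delta>) \<alpha> = deriv_map \<delta> (?f \<beta>) \<alpha>" if "\<alpha> \<in> Fe" "\<alpha> \<inter> (S \<union> \<delta>) = {}" for \<alpha>
      proof -
        have "\<not> \<beta> \<subseteq> \<alpha>" "\<beta> \<subseteq> \<alpha> \<union> \<delta> \<longleftrightarrow> \<beta> - \<delta> \<subseteq> \<alpha>"
          using False that by blast+
        then show ?thesis
          using c by (simp add: deriv_map_def)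
      qed
    qed
  qed
  then show ?case
    using Suc.prems by (auto simp: Gs_one intro: Gs_le)
qed

section \<open>Comparison with the recursive definition\<close>

lemma poly_fuel_imp_poly_upto:
  assumes "poly_fuel G n (\<lambda>i. Gs (t + i)) g"
  shows "poly_upto m S t g"
  using assms
proof (induction n arbitrary: m S t g)
  case 0
  \<comment> \<open>With no fuel left the map is trivial on \<open>Fe\<close>, so its derivatives
    vanish to every order \<open>m\<close>, however large.\<close>
  then have "\<And>\<alpha>. \<alpha> \<in> Fe \<Longrightarrow> \<one> = g \<alpha>" by simp
  then show ?case
    using poly_upto_cong_imp[OF poly_upto_one] by blast
next
  case (Suc n)
  show ?case
  proof (cases "Gs t = {\<one>} \<and> (\<forall>\<alpha>\<in>Fe. g \<alpha> = \<one>)")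
    case True
    then have "\<And>\<alpha>. \<alpha> \<in> Fe \<Longrightarrow> \<one> = g \<alpha>" by simp
    then show ?thesis
      using poly_upto_cong_imp[OF poly_upto_one] by blast
  next
    case False
    then have val: "\<forall>\<alpha>\<in>Fe. g \<alpha> \<in> Gs t" and der: "\<forall>\<beta>\<in>Fe. \<exists>h. poly_fuel G n (\<lambda>i. Gs (Suc t + i)) h \<and>
         (\<forall>\<alpha>\<in>Fe. \<alpha> \<inter> \<beta> = {} \<longrightarrow> h \<alpha> = inv (g \<alpha>) \<otimes> g (\<alpha> \<union> \<beta>))"
      using Suc.prems by auto
    show ?thesis
    proof (cases m)
      case 0
      then show ?thesis using val by simp
    next
      case (Suc k)
      have "poly_upto k (S \<union> \<beta>) (Suc t) (deriv_map \<beta> g)" if \<beta>: "\<beta> \<in> Fe" for \<beta>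
      proof -
        obtain h where h: "poly_fuel G n (\<lambda>i. Gs (Suc t + i)) h"
          "\<forall>\<alpha>\<in>Fe. \<alpha> \<inter> \<beta> = {} \<longrightarrow> h \<alpha> = inv (g \<alpha>) \<otimes> g (\<alpha> \<union> \<beta>)"
          using der \<beta> by blast
        \<comment> \<open>The extension \<open>h\<close> agrees with
          \<open>deriv_map \<beta> g\<close> on sets disjoint from \<open>\<beta>\<close>, and
          \<open>poly_upto\<close> with excluded set \<open>S \<union> \<beta>\<close> looks at no
          others.\<close>
        show ?thesis
          by (rule poly_upto_cong_imp[OF Suc.IH[OF h(1)]]) (use h(2) in \<open>auto simp: deriv_map_def\<close>)
      qed
      then show ?thesis using val Suc by simp
    qed
  qed
qed

text \<open>Removing \<open>S\<close> from the argument extends a map controlled only away from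
  \<open>S\<close> to all of \<open>Fe\<close>; this supplies the totally defined derivatives that
  \<open>poly_fuel\<close> asks for. The fuel \<open>n\<close> lasts precisely until the trivial
  level \<open>t + n\<close>.\<close>

lemma poly_upto_imp_poly_fuel:
  assumes "poly_upto n S t g" "Gs (t + n) = {\<one>}" "S \<in> Fe"
  shows "poly_fuel G n (\<lambda>i. Gs (t + i)) (\<lambda>\<alpha>. g (\<alpha> - S))"
  using assms
proof (induction n arbitrary: S t g)
  case 0
  then show ?case
    using Fe_Diff by (auto simp: Int_commute)
next
  case (Suc n)
  have "g (\<alpha> - S) \<in> Gs t" if "\<alpha> \<in> Fe" for \<alpha>
    using poly_upto_value[OF Suc.prems(1)] that Fe_Diff by auto
  moreover have "\<exists>h. poly_fuel G n (\<lambda>i. Gs (t + Suc i)) h \<and>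
         (\<forall>\<alpha>\<in>Fe. \<alpha> \<inter> \<beta> = {} \<longrightarrow> h \<alpha> = inv (g (\<alpha> - S)) \<otimes> g (\<alpha> \<union> \<beta> - S))"
    if \<beta>: "\<beta> \<in> Fe" for \<beta>
  proof (intro exI conjI ballI impI)
    \<comment> \<open>On the extended map the direction \<open>\<beta>\<close> acts through its part
      outside \<open>S\<close>, which is an admissible direction for \<open>g\<close>.\<close>
    let ?\<delta> = "\<beta> - S"
    have \<delta>: "?\<delta> \<in> Fe" "?\<delta> \<inter> S = {}" "S \<union> ?\<delta> \<in> Fe"
      using \<beta> Fe_Diff Fe_Un Suc.prems(3) by auto
    have "poly_fuel G n (\<lambda>i. Gs (Suc t + i)) (\<lambda>\<alpha>. deriv_map ?\<delta> g (\<alpha> - (S \<union> ?\<delta>)))"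
      by (rule Suc.IH) (use Suc.prems \<delta> in auto)
    then show "poly_fuel G n (\<lambda>i. Gs (t + Suc i)) (\<lambda>\<alpha>. deriv_map ?\<delta> g (\<alpha> - (S \<union> ?\<delta>)))"
      by simp
    show "deriv_map ?\<delta> g (\<alpha> - (S \<union> ?\<delta>)) = inv (g (\<alpha> - S)) \<otimes> g (\<alpha> \<union> \<beta> - S)"
      if "\<alpha> \<inter> \<beta> = {}" for \<alpha>
    proof -
      have "\<alpha> - (S \<union> ?\<delta>) = \<alpha> - S" "\<alpha> - S \<union> ?\<delta> = \<alpha> \<union> \<beta> - S"
        using that by auto
      then show ?thesis by (simp add: deriv_map_def)
    qed
  qed
  ultimately show ?case by auto
qed

text \<open>Asking for every order at once removes the fuel and turns polynomiality into an
  intersection of conditions on values. Conversely, order \<open>d\<close> supplies enough fuel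
  because level \<open>d\<close> is trivial.\<close>

lemma poly_map_iff:
  assumes "Gs d = {\<one>}"
  shows "poly_map G Gs g \<longleftrightarrow> (\<forall>n. poly_upto n {} 0 g)"
proof
  assume "poly_map G Gs g"
  then show "\<forall>n. poly_upto n {} 0 g"
    using poly_fuel_imp_poly_upto[of _ 0] by (auto simp: poly_map_def)
next
  assume "\<forall>n. poly_upto n {} 0 g"
  then have "poly_fuel G d Gs g"
    using poly_upto_imp_poly_fuel[of d "{}" 0 g] assms by (simp add: Fe_def)
  then show "poly_map G Gs g"
    by (auto simp: poly_map_def)
qed

end


section \<open>Coset spaces and compact sets of representatives\<close>

locale filtered_topological_group = filtered_group G Gs for G (structure) and Gs +
  fixes T :: "'a topology"
  assumes topological_group: "topological_group G T"
    and Gs_closedin: "closedin T (Gs i)"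
begin

lemma topspace_T [simp]: "topspace T = carrier G"
  using topological_group by (simp add: topological_group_def)

lemma continuous_map_mult:
  assumes "continuous_map Y T f" "continuous_map Y T g"
  shows "continuous_map Y T (\<lambda>x. f x \<otimes> g x)"
proof -
  have "continuous_map (prod_topology T T) T (\<lambda>(x, y). x \<otimes> y)"
    using topological_group by (simp add: topological_group_def)
  from continuous_map_compose[OF continuous_map_pairedI[OF assms] this] show ?thesis
    by (simp add: o_def)
qed

lemma continuous_map_inv:
  assumes "continuous_map Y T f"
  shows "continuous_map Y T (\<lambda>x. inv (f x))"
proof -
  have "continuous_map T T (\<lambda>x. inv x)"
    using topological_group by (simp add: topological_group_def)
  from continuous_map_compose[OF assms this] show ?thesis
    by (simp add: o_def)
qed

text \<open>A point of \<open>H\<close> lies in exactly one coset of \<open>K\<close>, so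
  \<open>H \<inter> \<Union>U\<close> is the preimage of \<open>U\<close> under the projection.
  Preimages commute with intersections and unions, hence the predicate in
  \<open>quotient_top\<close> really is a topology.\<close>

lemma openin_quotient_top:
  assumes H: "subgroup H G" and K: "subgroup K G"
  shows "openin (quotient_top G T H K) U \<longleftrightarrow>
    U \<subseteq> coset_space G H K \<and> openin (subtopology T H) {x \<in> H. x <# K \<in> U}"
proof -
  have Union_eq: "H \<inter> \<Union>U = {x \<in> H. x <# K \<in> U}" if U: "U \<subseteq> coset_space G H K" for U
  proof (intro equalityI subsetI)
    fix x assume "x \<in> H \<inter> \<Union>U"
    then obtain h where h: "x \<in> H" "x \<in> h <# K" "h <# K \<in> U" "h \<in> H"
      using U by (auto simp: coset_space_def)
    then have "h <# K = x <# K"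
      using l_repr_independence K subgroup.mem_carrier[OF H] by blast
    then show "x \<in> {x \<in> H. x <# K \<in> U}" using h by simp
  next
    fix x assume x: "x \<in> {x \<in> H. x <# K \<in> U}"
    then have "x \<in> x <# K"
      using subgroup.one_closed[OF K] subgroup.mem_carrier[OF H] by (force simp: l_coset_def)
    then show "x \<in> H \<inter> \<Union>U" using x by blast
  qed
  define P where "P = (\<lambda>U. U \<subseteq> coset_space G H K \<and> openin (subtopology T H) {x \<in> H. x <# K \<in> U})"
  have "istopology P"
    unfolding istopology_def
  proof (intro conjI allI impI)
    fix U V assume "P U" "P V"
    moreover have "{x \<in> H. x <# K \<in> U \<inter> V} = {x \<in> H. x <# K \<in> U} \<inter> {x \<in> H. x <# K \<in> V}"
      by auto
    ultimately show "P (U \<inter> V)"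
      by (auto simp: P_def)
  next
    fix \<U> assume "\<forall>U\<in>\<U>. P U"
    moreover have "{x \<in> H. x <# K \<in> \<Union>\<U>} = (\<Union>U\<in>\<U>. {x \<in> H. x <# K \<in> U})"
      by auto
    ultimately show "P (\<Union>\<U>)"
      by (auto simp: P_def)
  qed
  moreover have "(\<lambda>U. U \<subseteq> coset_space G H K \<and> openin (subtopology T H) (H \<inter> \<Union>U)) = P"
    using Union_eq by (auto simp: P_def fun_eq_iff)
  ultimately show ?thesis
    by (simp add: quotient_top_def topology_inverse' P_def)
qed

lemma topspace_quotient_top:
  assumes H: "subgroup H G" and K: "subgroup K G"
  shows "topspace (quotient_top G T H K) = coset_space G H K"
proof
  show "topspace (quotient_top G T H K) \<subseteq> coset_space G H K"
    using openin_quotient_top[OF assms] openin_topspace by blast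
  have "H \<subseteq> topspace T"
    using subgroup.subset[OF H] by simp
  then have "openin (subtopology T H) H"
    by (metis openin_topspace topspace_subtopology_subset)
  moreover have "{x \<in> H. x <# K \<in> coset_space G H K} = H"
    by (auto simp: coset_space_def)
  ultimately have "openin (quotient_top G T H K) (coset_space G H K)"
    using openin_quotient_top[OF assms] by simp
  then show "coset_space G H K \<subseteq> topspace (quotient_top G T H K)"
    by (rule openin_subset)
qed

lemma continuous_map_quotient_top:
  assumes K: "subgroup K G"
  shows "continuous_map T (quotient_top G T (carrier G) K) (\<lambda>x. x <# K)"
proof -
  have "subtopology T (carrier G) = T"
    by (metis subtopology_topspace topspace_T)
  then show ?thesis
    by (auto simp: continuous_map_def topspace_quotient_top openin_quotient_top subgroup_self K coset_space_def)
qed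

text \<open>Local compactness covers \<open>H\<close> by open sets contained in compact ones. Their
  images in the coset space are open, finitely many of these images cover it, and the union of the
  corresponding compact sets meets every coset.\<close>

lemma cocompact_imp_compact_representatives:
  assumes "locally_compact_space T" "closedin T H" "subgroup H G" "subgroup K G" "K \<subseteq> H"
    and "cocompact G T H K"
  shows "\<exists>C. compactin T C \<and> (\<forall>x\<in>H. \<exists>k\<in>K. x \<otimes> k \<in> C)"
proof -
  let ?H = "subtopology T H" and ?Q = "quotient_top G T H K"
  have HG: "H \<subseteq> carrier G" and KG: "K \<subseteq> carrier G"
    using assms subgroup.subset by auto
  have top_H: "topspace ?H = H"
    using HG by (simp add: topspace_subtopology Int_absorb1)
  have "locally_compact_space ?H"
    using assms locally_compact_space_closed_subset by blast
  then obtain U C where UC: "\<And>x. x \<in> H \<Longrightarrow> openin ?H (U x) \<and> compactin ?H (C x) \<and> x \<in> U x \<and> U x \<subseteq> C x"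
    unfolding locally_compact_space_def top_H by metis
  define V where "V = (\<lambda>x. (\<lambda>y. y <# K) ` U x)"
  have UH: "U x \<subseteq> H" if "x \<in> H" for x
    using UC[OF that] openin_subset top_H by blast
  have coset_in_V: "z <# K \<in> V x \<longleftrightarrow> (\<exists>k\<in>K. z \<otimes> k \<in> U x)" if x: "x \<in> H" and z: "z \<in> H" for x z
  proof
    assume "z <# K \<in> V x"
    then obtain y where y: "y \<in> U x" "z <# K = y <# K"
      by (auto simp: V_def)
    then have "y \<in> y <# K"
      using UH[OF x] HG subgroup.one_closed[OF assms(4)] by (force simp: l_coset_def)
    then have "y \<in> z <# K"
      using y by simp
    then show "\<exists>k\<in>K. z \<otimes> k \<in> U x"
      using y by (auto simp: l_coset_def)
  next
    assume "\<exists>k\<in>K. z \<otimes> k \<in> U x"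
    then obtain k where k: "k \<in> K" "z \<otimes> k \<in> U x" by blast
    then have "z <# K = (z \<otimes> k) <# K"
      using z HG assms(4) by (intro l_repr_independence) (auto simp: l_coset_def)
    then show "z <# K \<in> V x"
      using k by (auto simp: V_def)
  qed
  have "openin ?Q (V x)" if x: "x \<in> H" for x
  proof -
    \<comment> \<open>The preimage of \<open>V x\<close> in \<open>H\<close> is a union of right
      translates of \<open>U x\<close> by elements of \<open>K\<close>, and each translate is the
      preimage of \<open>U x\<close> under a right multiplication.\<close>
    have "openin ?H {z \<in> topspace ?H. z \<otimes> k \<in> U x}" if k: "k \<in> K" for k
    proof (rule openin_continuous_map_preimage)
      have "continuous_map ?H T (\<lambda>z. z \<otimes> k)"
        by (intro continuous_map_mult continuous_map_from_subtopology) (use k KG in auto)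
      moreover have "z \<otimes> k \<in> H" if "z \<in> H" for z
        using that k assms(5) by (intro subgroup.m_closed[OF assms(3)]) auto
      ultimately show "continuous_map ?H ?H (\<lambda>z. z \<otimes> k)"
        using top_H by (auto simp: continuous_map_in_subtopology)
    qed (use UC x in blast)
    then have "openin ?H (\<Union>k\<in>K. {z \<in> H. z \<otimes> k \<in> U x})"
      unfolding top_H by blast
    moreover have "{z \<in> H. z <# K \<in> V x} = (\<Union>k\<in>K. {z \<in> H. z \<otimes> k \<in> U x})"
      using coset_in_V[OF x] by blast
    moreover have "V x \<subseteq> coset_space G H K"
      using UH[OF x] by (auto simp: V_def coset_space_def)
    ultimately show ?thesis
      by (simp add: openin_quotient_top assms)
  qed
  moreover have "topspace ?Q \<subseteq> \<Union>(V ` H)"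
    using UC by (auto simp: topspace_quotient_top assms coset_space_def V_def)
  ultimately have "\<exists>\<F>. finite \<F> \<and> \<F> \<subseteq> V ` H \<and> topspace ?Q \<subseteq> \<Union>\<F>"
    using assms(6) unfolding cocompact_def compact_space_alt by (simp add: image_iff)
  then obtain \<F> where \<F>: "finite \<F>" "\<F> \<subseteq> V ` H" "topspace ?Q \<subseteq> \<Union>\<F>"
    by blast
  obtain A where "A \<subseteq> H" "finite A" "\<F> = V ` A"
    using finite_subset_image[OF \<F>(1,2)] by blast
  with \<F>(3) have A: "finite A" "A \<subseteq> H" "topspace ?Q \<subseteq> \<Union>(V ` A)"
    by simp_all
  show ?thesis
  proof (intro exI conjI ballI)
    show "compactin T (\<Union>x\<in>A. C x)"
      using A UC by (intro compactin_Union) (auto simp: compactin_subtopology)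
    fix z assume z: "z \<in> H"
    then have "z <# K \<in> topspace ?Q"
      by (auto simp: topspace_quotient_top assms coset_space_def)
    then obtain x where "x \<in> A" "z <# K \<in> V x"
      using A(3) by auto
    moreover from \<open>x \<in> A\<close> A(2) have "x \<in> H"
      by blast
    ultimately obtain k where "k \<in> K" "z \<otimes> k \<in> U x"
      using coset_in_V[of x z] z by blast
    moreover have "U x \<subseteq> C x"
      using UC[OF \<open>x \<in> H\<close>] by blast
    ultimately show "\<exists>k\<in>K. z \<otimes> k \<in> (\<Union>x\<in>A. C x)"
      using \<open>x \<in> A\<close> by blast
  qed
qed

section \<open>The closed set of polynomial maps and its values\<close>

abbreviation Maps :: "(nat set \<Rightarrow> 'a) topology" where
  "Maps \<equiv> product_topology (\<lambda>_. T) Fe"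

lemma continuous_map_deriv_map:
  assumes "\<beta> \<in> Fe"
  shows "continuous_map Maps Maps (\<lambda>g. restrict (deriv_map \<beta> g) Fe)"
proof -
  have "continuous_map Maps T (\<lambda>g. deriv_map \<beta> g \<alpha>)" if "\<alpha> \<in> Fe" for \<alpha>
    unfolding deriv_map_def
    by (intro continuous_map_mult continuous_map_inv continuous_map_product_projection)
      (use that assms Fe_Un in auto)
  then show ?thesis
    by (auto simp: continuous_map_componentwise)
qed

lemma closedin_Collect_Ball:
  assumes "\<And>i. i \<in> I \<Longrightarrow> closedin X {x \<in> topspace X. P i x}"
  shows "closedin X {x \<in> topspace X. \<forall>i\<in>I. P i x}"
\<comment> \<open>For empty \<open>I\<close> the set is the whole space, whereas the intersection of
  the empty family would be the universe of the type.\<close>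
proof (cases "I = {}")
  case False
  then have "{x \<in> topspace X. \<forall>i\<in>I. P i x} = (\<Inter>i\<in>I. {x \<in> topspace X. P i x})"
    by auto
  then show ?thesis
    using assms False by auto
qed simp

lemma closedin_values:
  "closedin Maps {g \<in> topspace Maps. \<forall>\<alpha>\<in>Fe. \<alpha> \<inter> S = {} \<longrightarrow> g \<alpha> \<in> Gs t}"
proof -
  have "closedin Maps {g \<in> topspace Maps. \<forall>\<alpha>\<in>{\<alpha> \<in> Fe. \<alpha> \<inter> S = {}}. g \<alpha> \<in> Gs t}"
    by (intro closedin_Collect_Ball closedin_continuous_map_preimage[OF continuous_map_product_projection]
          Gs_closedin) simp
  then show ?thesis
    by (rule back_subst[of "closedin Maps"]) blast
qed

text \<open>By induction on the order: the value conditions are preimages of closed subgroups under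
  evaluations, and the derivative conditions are preimages of closed sets under the continuous
  derivative maps.\<close>

lemma closedin_poly_upto: "closedin Maps {g \<in> topspace Maps. poly_upto n S t g}"
proof (induction n arbitrary: S t)
  case 0
  then show ?case
    using closedin_values by simp
next
  case (Suc n)
  have der: "closedin Maps {g \<in> topspace Maps.
      \<forall>\<beta>\<in>{\<beta> \<in> Fe. \<beta> \<inter> S = {}}. poly_upto n (S \<union> \<beta>) (Suc t) (deriv_map \<beta> g)}"
  proof (rule closedin_Collect_Ball)
    fix \<beta> assume "\<beta> \<in> {\<beta> \<in> Fe. \<beta> \<inter> S = {}}"
    then have cont: "continuous_map Maps Maps (\<lambda>g. restrict (deriv_map \<beta> g) Fe)"
      by (intro continuous_map_deriv_map) simp
    have "closedin Maps {g \<in> topspace Maps. restrict (deriv_map \<beta> g) Fe \<in>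
        {g \<in> topspace Maps. poly_upto n (S \<union> \<beta>) (Suc t) g}}"
      by (rule closedin_continuous_map_preimage[OF cont Suc.IH])
    \<comment> \<open>The restriction makes the derivative a point of \<open>Maps\<close>;
      \<open>poly_upto\<close> does not see it.\<close>
    moreover have "restrict (deriv_map \<beta> g) Fe \<in> {g \<in> topspace Maps. poly_upto n (S \<union> \<beta>) (Suc t) g}
        \<longleftrightarrow> poly_upto n (S \<union> \<beta>) (Suc t) (deriv_map \<beta> g)" if "g \<in> topspace Maps" for g
    proof -
      have "restrict (deriv_map \<beta> g) Fe \<in> topspace Maps"
        using continuous_map_image_subset_topspace[OF cont] that by blast
      moreover have "poly_upto n (S \<union> \<beta>) (Suc t) (restrict (deriv_map \<beta> g) Fe)
          \<longleftrightarrow> poly_upto n (S \<union> \<beta>) (Suc t) (deriv_map \<beta> g)"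
        by (rule poly_upto_cong) simp
      ultimately show ?thesis by blast
    qed
    ultimately show "closedin Maps {g \<in> topspace Maps. poly_upto n (S \<union> \<beta>) (Suc t) (deriv_map \<beta> g)}"
      by (metis (no_types, lifting) Collect_cong)
  qed
  have "{g \<in> topspace Maps. poly_upto (Suc n) S t g} =
      {g \<in> topspace Maps. \<forall>\<alpha>\<in>Fe. \<alpha> \<inter> S = {} \<longrightarrow> g \<alpha> \<in> Gs t} \<inter>
      {g \<in> topspace Maps. \<forall>\<beta>\<in>{\<beta> \<in> Fe. \<beta> \<inter> S = {}}. poly_upto n (S \<union> \<beta>) (Suc t) (deriv_map \<beta> g)}"
    by auto
  then show ?case
    using closedin_Int[OF closedin_values der] by simp
qed

definition polys :: "(nat set \<Rightarrow> 'a) set" where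
  "polys = {g \<in> topspace Maps. \<forall>n. poly_upto n {} 0 g}"

lemma closedin_polys: "closedin Maps polys"
  using closedin_Collect_Ball[of UNIV Maps "\<lambda>n. poly_upto n {} 0"] closedin_poly_upto
  by (simp add: polys_def)

text \<open>The derivative of order \<open>card \<beta>\<close> along the singletons of \<open>\<beta>\<close>, taken at \<open>{}\<close>, is a word in
  the values of \<open>g\<close> on subsets of \<open>\<beta>\<close> in which \<open>g \<beta>\<close> occurs once, as the last letter.\<close>

lemma top_value_mod_Gs:
  assumes "finite \<beta>" "\<beta> \<in> Fe"
  shows "\<exists>F. continuous_map Maps T F \<and> (\<forall>g h. (\<forall>\<alpha>. \<alpha> \<subset> \<beta> \<longrightarrow> g \<alpha> = h \<alpha>) \<longrightarrow> F g = F h) \<and>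
    (\<forall>n S t g. card \<beta> \<le> n \<longrightarrow> \<beta> \<inter> S = {} \<longrightarrow> g \<in> topspace Maps \<longrightarrow> poly_upto n S t g \<longrightarrow>
       F g \<otimes> g \<beta> \<in> Gs (t + card \<beta>))"
  using assms
proof (induction \<beta> rule: finite_induct)
  case empty
  have "\<one> \<otimes> g {} \<in> Gs t" if "poly_upto n S t g" for n S t g
    using poly_upto_value[OF that, of "{}"] Gs_carrier by (simp add: Fe_def)
  then show ?case
    by (intro exI[of _ "\<lambda>_. \<one>"]) auto
next
  case (insert i \<beta>)
  have Fe: "\<beta> \<in> Fe" "{i} \<in> Fe"
    using insert.prems Fe_subset by auto
  obtain F where F: "continuous_map Maps T F"
    "\<And>g h. \<forall>\<alpha>. \<alpha> \<subset> \<beta> \<longrightarrow> g \<alpha> = h \<alpha> \<Longrightarrow> F g = F h"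
    "\<And>n S t g. card \<beta> \<le> n \<Longrightarrow> \<beta> \<inter> S = {} \<Longrightarrow> g \<in> topspace Maps \<Longrightarrow> poly_upto n S t g \<Longrightarrow>
       F g \<otimes> g \<beta> \<in> Gs (t + card \<beta>)"
    using insert.IH[OF Fe(1)] by metis
  let ?D = "\<lambda>g. restrict (deriv_map {i} g) Fe"
  have D: "continuous_map Maps Maps ?D"
    by (rule continuous_map_deriv_map[OF Fe(2)])
  show ?case
  \<comment> \<open>The derivative of \<open>g\<close> along \<open>{i}\<close> at
    \<open>\<beta>\<close> is \<open>inv (g \<beta>) \<otimes> g (insert i \<beta>)\<close>. Its
    factor \<open>inv (g \<beta>)\<close> is absorbed into the word, leaving
    \<open>g (insert i \<beta>)\<close> as the last letter.\<close>
  proof (intro exI[of _ "\<lambda>g. F (?D g) \<otimes> inv (g \<beta>)"] conjI allI impI)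
    show "continuous_map Maps T (\<lambda>g. F (?D g) \<otimes> inv (g \<beta>))"
      using continuous_map_compose[OF D F(1)] Fe(1)
      by (intro continuous_map_mult continuous_map_inv continuous_map_product_projection)
        (simp_all add: o_def)
  next
    fix g h :: "nat set \<Rightarrow> 'a"
    assume eq: "\<forall>\<alpha>. \<alpha> \<subset> insert i \<beta> \<longrightarrow> g \<alpha> = h \<alpha>"
    have "?D g \<alpha> = ?D h \<alpha>" if "\<alpha> \<subset> \<beta>" for \<alpha>
    proof -
      have "\<alpha> \<subset> insert i \<beta>" "\<alpha> \<union> {i} \<subset> insert i \<beta>"
        using that insert.hyps by auto
      then show ?thesis
        using eq by (simp add: deriv_map_def restrict_def)
    qed
    then have "F (?D g) = F (?D h)"
      using F(2) by blast
    moreover have "\<beta> \<subset> insert i \<beta>"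
      using insert.hyps by auto
    ultimately show "F (?D g) \<otimes> inv (g \<beta>) = F (?D h) \<otimes> inv (h \<beta>)"
      using eq by simp
  next
    fix n S t g
    assume n: "card (insert i \<beta>) \<le> n" and S: "insert i \<beta> \<inter> S = {}"
      and g: "g \<in> topspace Maps" "poly_upto n S t g"
    then obtain k where k: "n = Suc k" "card \<beta> \<le> k"
      using insert.hyps by (cases n) auto
    have Dg: "?D g \<in> topspace Maps"
      using continuous_map_image_subset_topspace[OF D] g(1) by blast
    have "\<forall>\<delta>\<in>Fe. \<delta> \<inter> S = {} \<longrightarrow> poly_upto k (S \<union> \<delta>) (Suc t) (deriv_map \<delta> g)"
      using g(2) k(1) by simp
    moreover have "{i} \<inter> S = {}"
      using S by blast
    ultimately have "poly_upto k (S \<union> {i}) (Suc t) (deriv_map {i} g)"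
      using Fe(2) by blast
    then have "poly_upto k (S \<union> {i}) (Suc t) (?D g)"
      by (rule poly_upto_cong_imp) simp
    \<comment> \<open>Differentiating trades one order for one level, matching the growth of the
      cardinality by one; \<open>\<beta>\<close> avoids the enlarged excluded set as it does not
      contain \<open>i\<close>.\<close>
    then have "F (?D g) \<otimes> ?D g \<beta> \<in> Gs (Suc t + card \<beta>)"
      using F(3)[of k "S \<union> {i}" "?D g" "Suc t"] k S insert.hyps Dg by auto
    moreover have "F (?D g) \<in> carrier G"
      using continuous_map_image_subset_topspace[OF F(1)] Dg by auto
    moreover have "g \<beta> \<in> carrier G" "g (insert i \<beta>) \<in> carrier G"
      using g(1) Fe insert.prems by auto
    ultimately show "F (?D g) \<otimes> inv (g \<beta>) \<otimes> g (insert i \<beta>) \<in> Gs (t + card (insert i \<beta>))"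
      using insert.hyps Fe by (simp add: deriv_map_def m_assoc)
  qed
qed

text \<open>The correction move at \<open>\<beta>\<close>: only values on supersets of
  \<open>\<beta>\<close> change, and \<open>g \<beta>\<close> becomes
  \<open>g \<beta> \<otimes> c\<close>.\<close>

lemma polys_mult_face:
  assumes g: "g \<in> polys" and \<beta>: "\<beta> \<in> Fe" and c: "c \<in> Gs (card \<beta>)"
  shows "restrict (\<lambda>\<alpha>. g \<alpha> \<otimes> (if \<beta> \<subseteq> \<alpha> then c else \<one>)) Fe \<in> polys"
proof -
  have "poly_upto n {} 0 (\<lambda>\<alpha>. g \<alpha> \<otimes> (if \<beta> \<subseteq> \<alpha> then c else \<one>))" for n
    using g \<beta> c by (intro poly_upto_mult poly_upto_face) (auto simp: polys_def Fe_def)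
  then have "poly_upto n {} 0 (restrict (\<lambda>\<alpha>. g \<alpha> \<otimes> (if \<beta> \<subseteq> \<alpha> then c else \<one>)) Fe)" for n
    by (rule poly_upto_cong_imp) simp
  then show ?thesis
    using g c Gs_carrier by (auto simp: polys_def)
qed

section \<open>Correction modulo \<Gamma> and compactness\<close>

context
  fixes \<Gamma> :: "'a set"
  assumes \<Gamma>: "subgroup \<Gamma> G"
    and representatives: "\<And>i. \<exists>C. compactin T C \<and> (\<forall>x\<in>Gs i. \<exists>c\<in>Gs i \<inter> \<Gamma>. x \<otimes> c \<in> C)"
begin

text \<open>Some \<open>c\<close> moves \<open>F g \<otimes> g \<beta>\<close> into a compact set
  \<open>C\<close>, so \<open>g \<beta> \<otimes> c\<close> lies in the translate of
  \<open>C\<close> by \<open>inv (F g)\<close>. As \<open>F g\<close> depends only on values below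
  \<open>\<beta>\<close>, which lie in compact sets, all these translates stay in one compact
  set.\<close>

lemma compact_correction_step:
  assumes \<beta>: "\<beta> \<in> Fe" and K: "\<And>\<alpha>. \<alpha> \<subset> \<beta> \<Longrightarrow> compactin T (K \<alpha>)"
  shows "\<exists>K'. compactin T K' \<and> (\<forall>g\<in>polys. (\<forall>\<alpha>. \<alpha> \<subset> \<beta> \<longrightarrow> g \<alpha> \<in> K \<alpha>) \<longrightarrow>
    (\<exists>c\<in>Gs (card \<beta>) \<inter> \<Gamma>. g \<beta> \<otimes> c \<in> K'))"
proof -
  have fin: "finite \<beta>" using \<beta> by (simp add: Fe_def)
  obtain F where F: "continuous_map Maps T F"
    "\<And>g h. \<forall>\<alpha>. \<alpha> \<subset> \<beta> \<longrightarrow> g \<alpha> = h \<alpha> \<Longrightarrow> F g = F h"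
    "\<And>n S t g. card \<beta> \<le> n \<Longrightarrow> \<beta> \<inter> S = {} \<Longrightarrow> g \<in> topspace Maps \<Longrightarrow> poly_upto n S t g \<Longrightarrow>
       F g \<otimes> g \<beta> \<in> Gs (t + card \<beta>)"
    using top_value_mod_Gs[OF fin \<beta>] by metis
  obtain C where C: "compactin T C" "\<And>x. x \<in> Gs (card \<beta>) \<Longrightarrow> \<exists>c\<in>Gs (card \<beta>) \<inter> \<Gamma>. x \<otimes> c \<in> C"
    using representatives by metis
  \<comment> \<open>\<open>F\<close> ignores the values at sets other than proper subsets of
    \<open>\<beta>\<close>; fixing them to be trivial gives a compact product without changing the
    values of \<open>F\<close> that occur.\<close>
  define A where "A = PiE Fe (\<lambda>\<alpha>. if \<alpha> \<subset> \<beta> then K \<alpha> else {\<one>})"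
  have "compactin Maps A"
    unfolding A_def compactin_PiE using K by simp
  with C(1) have "compactin (prod_topology Maps T) (A \<times> C)"
    by (simp add: compactin_Times)
  moreover have "continuous_map (prod_topology Maps T) T (\<lambda>p. inv (F (fst p)) \<otimes> snd p)"
    using continuous_map_compose[OF continuous_map_fst F(1)]
    by (intro continuous_map_mult continuous_map_inv continuous_map_snd) (simp add: o_def)
  ultimately have "compactin T ((\<lambda>p. inv (F (fst p)) \<otimes> snd p) ` (A \<times> C))"
    by (rule image_compactin)
  moreover have "\<exists>c\<in>Gs (card \<beta>) \<inter> \<Gamma>. g \<beta> \<otimes> c \<in> (\<lambda>p. inv (F (fst p)) \<otimes> snd p) ` (A \<times> C)"
    if g: "g \<in> polys" and gK: "\<And>\<alpha>. \<alpha> \<subset> \<beta> \<Longrightarrow> g \<alpha> \<in> K \<alpha>" for g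
  proof -
    have "F g \<otimes> g \<beta> \<in> Gs (card \<beta>)"
      using F(3)[of "card \<beta>" "{}" g 0] g by (simp add: polys_def)
    then obtain c where c: "c \<in> Gs (card \<beta>) \<inter> \<Gamma>" "F g \<otimes> g \<beta> \<otimes> c \<in> C"
      using C(2) by blast
    define h where "h = restrict (\<lambda>\<alpha>. if \<alpha> \<subset> \<beta> then g \<alpha> else \<one>) Fe"
    have "h \<in> A"
      using gK by (auto simp: A_def h_def)
    have "F h = F g"
      by (rule F(2)) (use Fe_subset[OF \<beta>] in \<open>auto simp: h_def\<close>)
    have "g \<beta> \<in> carrier G" "F g \<in> carrier G" "c \<in> carrier G"
      using g \<beta> F(1) c Gs_carrier by (auto simp: polys_def continuous_map_def)
    then have "g \<beta> \<otimes> c = inv (F h) \<otimes> (F g \<otimes> g \<beta> \<otimes> c)"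
      by (simp add: \<open>F h = F g\<close> m_assoc cancel_inv_left)
    then show ?thesis
      using c \<open>h \<in> A\<close> by (intro bexI[of _ c]) (auto simp: image_iff)
  qed
  ultimately show ?thesis by blast
qed

text \<open>Each \<open>K \<beta>\<close> is obtained from the sets at proper subsets of
  \<open>\<beta>\<close>, so well-founded recursion along \<open>finite_psubset\<close> yields the
  family. It is chosen before any polynomial and serves all of them.\<close>

lemma compact_correction_family:
  "\<exists>K. \<forall>\<beta>\<in>Fe. compactin T (K \<beta>) \<and> (\<forall>g\<in>polys. (\<forall>\<alpha>. \<alpha> \<subset> \<beta> \<longrightarrow> g \<alpha> \<in> K \<alpha>) \<longrightarrow>
    (\<exists>c\<in>Gs (card \<beta>) \<inter> \<Gamma>. g \<beta> \<otimes> c \<in> K \<beta>))"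
proof -
  let ?P = "\<lambda>K \<beta> K'. \<beta> \<in> Fe \<longrightarrow> compactin T K' \<and> (\<forall>g\<in>polys. (\<forall>\<alpha>. \<alpha> \<subset> \<beta> \<longrightarrow> g \<alpha> \<in> K \<alpha>) \<longrightarrow>
    (\<exists>c\<in>Gs (card \<beta>) \<inter> \<Gamma>. g \<beta> \<otimes> c \<in> K'))"
  have "\<exists>K. \<forall>\<beta>. ?P K \<beta> (K \<beta>)"
  proof (rule dependent_wf_choice[OF wf_finite_psubset])
    fix K L :: "nat set \<Rightarrow> 'a set" and \<beta> K'
    assume "\<And>z. (z, \<beta>) \<in> finite_psubset \<Longrightarrow> K z = L z"
    then have "\<beta> \<in> Fe \<Longrightarrow> \<alpha> \<subset> \<beta> \<Longrightarrow> K \<alpha> = L \<alpha>" for \<alpha>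
      by (simp add: Fe_def)
    then show "?P K \<beta> K' = ?P L \<beta> K'"
      by (intro imp_cong refl conj_cong ball_cong) auto
  next
    fix \<beta> and K :: "nat set \<Rightarrow> 'a set"
    assume "\<And>\<alpha>. (\<alpha>, \<beta>) \<in> finite_psubset \<Longrightarrow> ?P K \<alpha> (K \<alpha>)"
    then have "\<beta> \<in> Fe \<Longrightarrow> \<alpha> \<subset> \<beta> \<Longrightarrow> compactin T (K \<alpha>)" for \<alpha>
      using Fe_subset[of \<beta> \<alpha>] by (auto simp: Fe_def)
    then show "\<exists>K'. ?P K \<beta> K'"
      using compact_correction_step[of \<beta> K] by blast
  qed
  then show ?thesis by blast
qed

text \<open>Multiplying by a function supported above \<open>\<beta>\<close> does not disturb the sets preceding \<open>\<beta>\<close> in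
  the order of \<open>set_encode\<close>, which extends inclusion.\<close>

lemma bounded_representative:
  assumes K: "\<And>\<beta> g. \<lbrakk>\<beta> \<in> Fe; g \<in> polys; \<And>\<alpha>. \<alpha> \<subset> \<beta> \<Longrightarrow> g \<alpha> \<in> K \<alpha>\<rbrakk> \<Longrightarrow>
      \<exists>c\<in>Gs (card \<beta>) \<inter> \<Gamma>. g \<beta> \<otimes> c \<in> K \<beta>"
    and g: "g \<in> polys"
  shows "\<exists>h\<in>polys. (\<forall>\<beta>\<in>Fe. h \<beta> \<in> K \<beta>) \<and> (\<forall>\<alpha>\<in>Fe. h \<alpha> <# \<Gamma> = g \<alpha> <# \<Gamma>)"
proof -
  \<comment> \<open>At stage \<open>k\<close> the sets with code below \<open>k\<close> have been
    treated and no coset has changed; \<open>?Q\<close> freezes the treated values when passing to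
    the next stage.\<close>
  let ?P = "\<lambda>k h. h \<in> polys \<and> (\<forall>j<k. set_decode j \<in> Fe \<longrightarrow> h (set_decode j) \<in> K (set_decode j)) \<and>
     (\<forall>\<alpha>\<in>Fe. h \<alpha> <# \<Gamma> = g \<alpha> <# \<Gamma>)"
  let ?Q = "\<lambda>k h h'. \<forall>j<k. set_decode j \<in> Fe \<longrightarrow> h' (set_decode j) = h (set_decode j)"
  have "\<exists>f. \<forall>n. ?P n (f n) \<and> ?Q n (f n) (f (Suc n))"
  proof (rule dependent_nat_choice)
    show "\<exists>h. ?P 0 h"
      using g by auto
  next
    fix h k assume P: "?P k h"
    let ?\<beta> = "set_decode k"
    show "\<exists>h'. ?P (Suc k) h' \<and> ?Q k h h'"
    proof (cases "?\<beta> \<in> Fe")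
      case False
      \<comment> \<open>Codes of sets containing 0 leave the map as it is.\<close>
      then show ?thesis
        using P by (intro exI[of _ h]) (auto simp: less_Suc_eq)
    next
      case \<beta>: True
      \<comment> \<open>Proper subsets of \<open>?\<beta>\<close> have smaller codes, so their
        values were brought into \<open>K\<close> at earlier stages.\<close>
      have "h \<alpha> \<in> K \<alpha>" if \<alpha>: "\<alpha> \<subset> ?\<beta>" for \<alpha>
      proof -
        have \<alpha>Fe: "\<alpha> \<in> Fe" using Fe_subset \<beta> \<alpha> by blast
        then have dec: "set_decode (set_encode \<alpha>) = \<alpha>"
          by (simp add: Fe_def)
        then have "set_encode \<alpha> \<le> k" "set_encode \<alpha> \<noteq> k"
          using subset_decode_imp_le[of "set_encode \<alpha>" k] \<alpha> by auto
        then show ?thesis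
          using P \<alpha>Fe dec by (metis le_neq_implies_less)
      qed
      then obtain c where c: "c \<in> Gs (card ?\<beta>)" "c \<in> \<Gamma>" "h ?\<beta> \<otimes> c \<in> K ?\<beta>"
        using K[of ?\<beta> h] \<beta> P by blast
      define h' where "h' = restrict (\<lambda>\<alpha>. h \<alpha> \<otimes> (if ?\<beta> \<subseteq> \<alpha> then c else \<one>)) Fe"
      have hG: "h \<alpha> \<in> carrier G" if "\<alpha> \<in> Fe" for \<alpha>
        using P that by (auto simp: polys_def)
      have "h' \<in> polys"
        unfolding h'_def using P \<beta> c by (intro polys_mult_face) auto
      moreover have Q: "?Q k h h'"
      proof (intro allI impI)
        fix j assume "j < k" "set_decode j \<in> Fe"
        moreover from \<open>j < k\<close> have "\<not> ?\<beta> \<subseteq> set_decode j"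
          using subset_decode_imp_le[of k j] by auto
        ultimately show "h' (set_decode j) = h (set_decode j)"
          using hG by (simp add: h'_def)
      qed
      moreover have "h' \<alpha> <# \<Gamma> = g \<alpha> <# \<Gamma>" if \<alpha>: "\<alpha> \<in> Fe" for \<alpha>
      proof -
        have "h' \<alpha> \<in> h \<alpha> <# \<Gamma>"
          using c \<alpha> subgroup.one_closed[OF \<Gamma>] by (auto simp: h'_def l_coset_def)
        then have "h \<alpha> <# \<Gamma> = h' \<alpha> <# \<Gamma>"
          using hG \<alpha> \<Gamma> l_repr_independence by blast
        then show ?thesis using P \<alpha> by simp
      qed
      moreover have "h' ?\<beta> \<in> K ?\<beta>"
        using c \<beta> by (simp add: h'_def)
      ultimately show ?thesis
        using P by (intro exI[of _ h']) (auto simp: less_Suc_eq)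
    qed
  qed
  then obtain f where PQ: "\<forall>n. ?P n (f n) \<and> ?Q n (f n) (f (Suc n))"
    by (rule exE)
  have f: "?P n (f n)" for n
    using spec[OF PQ, of n] by (rule conjunct1)
  have f_Suc: "?Q n (f n) (f (Suc n))" for n
    using spec[OF PQ, of n] by (rule conjunct2)
  \<comment> \<open>Stage \<open>k\<close> treats the set with code \<open>k\<close>, so its value
    is final from index \<open>Suc k\<close> on.\<close>
  have stable: "f m \<alpha> = f (Suc (set_encode \<alpha>)) \<alpha>" if "\<alpha> \<in> Fe" "Suc (set_encode \<alpha>) \<le> m" for m \<alpha>
    using that(2)
  proof (induction m rule: dec_induct)
    case (step m)
    have "set_decode (set_encode \<alpha>) = \<alpha>"
      using that(1) by (simp add: Fe_def)
    then show ?case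
      using f_Suc[of m] step that(1) by (metis Suc_le_lessD)
  qed simp
  define h where "h = restrict (\<lambda>\<alpha>. f (Suc (set_encode \<alpha>)) \<alpha>) Fe"
  have h_val: "h \<alpha> \<in> K \<alpha>" "h \<alpha> <# \<Gamma> = g \<alpha> <# \<Gamma>" "h \<alpha> \<in> carrier G" if "\<alpha> \<in> Fe" for \<alpha>
  proof -
    have "set_decode (set_encode \<alpha>) = \<alpha>"
      using that by (simp add: Fe_def)
    then show "h \<alpha> \<in> K \<alpha>" "h \<alpha> <# \<Gamma> = g \<alpha> <# \<Gamma>" "h \<alpha> \<in> carrier G"
      using f[of "Suc (set_encode \<alpha>)"] that by (auto simp: h_def polys_def)
  qed
  \<comment> \<open>Every coordinate of the sequence is eventually constant, so it converges
    pointwise to \<open>h\<close>; closedness of \<open>polys\<close> then carries polynomiality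
    through infinitely many corrections.\<close>
  have "limitin Maps f h sequentially"
    unfolding limitin_componentwise
  proof (intro conjI ballI)
    show "h \<in> extensional Fe" by (simp add: h_def)
    show "\<forall>\<^sub>F n in sequentially. f n \<in> topspace Maps"
      using f by (simp add: polys_def)
    show "limitin T (\<lambda>n. f n \<alpha>) (h \<alpha>) sequentially" if \<alpha>: "\<alpha> \<in> Fe" for \<alpha>
    proof (rule limitin_eventually)
      show "h \<alpha> \<in> topspace T" using h_val \<alpha> by simp
      show "\<forall>\<^sub>F n in sequentially. f n \<alpha> = h \<alpha>"
      proof (rule eventually_sequentiallyI)
        show "f n \<alpha> = h \<alpha>" if "Suc (set_encode \<alpha>) \<le> n" for n
          using stable[OF \<alpha> that] \<alpha> by (simp add: h_def)
      qed
    qed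
  qed
  then have "h \<in> polys"
    by (rule limitin_closedin[OF _ closedin_polys]) (use f in auto)
  then show ?thesis
    using h_val by blast
qed

text \<open>The polynomials with values in the family \<open>K\<close> form a closed part of a
  Tychonoff product of compact sets. By \<open>bounded_representative\<close> they already have the
  same image under the projection to cosets as all of \<open>polys\<close>.\<close>

lemma compactin_polys_quotient:
  "compactin (product_topology (\<lambda>_. quotient_top G T (carrier G) \<Gamma>) Fe)
     ((\<lambda>g. \<lambda>\<alpha>\<in>Fe. g \<alpha> <# \<Gamma>) ` polys)"
proof -
  let ?q = "\<lambda>g. \<lambda>\<alpha>\<in>Fe. g \<alpha> <# \<Gamma>"
  obtain K where K: "\<And>\<beta>. \<beta> \<in> Fe \<Longrightarrow> compactin T (K \<beta>)"
    "\<And>\<beta> g. \<lbrakk>\<beta> \<in> Fe; g \<in> polys; \<And>\<alpha>. \<alpha> \<subset> \<beta> \<Longrightarrow> g \<alpha> \<in> K \<alpha>\<rbrakk> \<Longrightarrow>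
      \<exists>c\<in>Gs (card \<beta>) \<inter> \<Gamma>. g \<beta> \<otimes> c \<in> K \<beta>"
    using compact_correction_family by metis
  have "compactin Maps (PiE Fe K)"
    using K(1) by (simp add: compactin_PiE)
  then have "compactin Maps (polys \<inter> PiE Fe K)"
    by (rule closed_Int_compactin[OF closedin_polys])
  moreover have "continuous_map Maps (product_topology (\<lambda>_. quotient_top G T (carrier G) \<Gamma>) Fe) ?q"
  proof -
    have "continuous_map Maps (quotient_top G T (carrier G) \<Gamma>) (\<lambda>g. g \<alpha> <# \<Gamma>)" if "\<alpha> \<in> Fe" for \<alpha>
      using continuous_map_compose[OF continuous_map_product_projection[OF that]
          continuous_map_quotient_top[OF \<Gamma>]] by (simp add: o_def)
    then show ?thesis
      by (auto simp: continuous_map_componentwise)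
  qed
  ultimately have "compactin (product_topology (\<lambda>_. quotient_top G T (carrier G) \<Gamma>) Fe)
      (?q ` (polys \<inter> PiE Fe K))"
    by (rule image_compactin)
  moreover have "?q ` (polys \<inter> PiE Fe K) = ?q ` polys"
  proof
    show "?q ` polys \<subseteq> ?q ` (polys \<inter> PiE Fe K)"
    proof
      fix y assume "y \<in> ?q ` polys"
      then obtain g where g: "g \<in> polys" "y = ?q g" by blast
      have "\<exists>h\<in>polys. (\<forall>\<beta>\<in>Fe. h \<beta> \<in> K \<beta>) \<and> (\<forall>\<alpha>\<in>Fe. h \<alpha> <# \<Gamma> = g \<alpha> <# \<Gamma>)"
        by (rule bounded_representative[OF _ g(1)]) (use K(2) in blast)
      then obtain h where h: "h \<in> polys" "\<forall>\<beta>\<in>Fe. h \<beta> \<in> K \<beta>" "\<forall>\<alpha>\<in>Fe. h \<alpha> <# \<Gamma> = g \<alpha> <# \<Gamma>"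
        by blast
      have "y = ?q h"
        unfolding g(2) by (rule restrict_ext) (use h(3) in simp)
      moreover have "h \<in> PiE Fe K"
        using h by (auto simp: polys_def PiE_iff)
      ultimately show "y \<in> ?q ` (polys \<inter> PiE Fe K)"
        using h by blast
    qed
  qed blast
  ultimately show ?thesis by simp
qed

end

section \<open>Passage to \<open>poly_quot\<close> and the compactness theorem\<close>

lemma poly_quot_eq:
  assumes "Gs d = {\<one>}" "Gs 0 = carrier G"
  shows "poly_quot G Gs \<Gamma> = (\<lambda>g. \<lambda>\<alpha>\<in>Fe. g \<alpha> <# \<Gamma>) ` polys"
proof (intro equalityI subsetI)
  fix y assume "y \<in> poly_quot G Gs \<Gamma>"
  then obtain g where y: "y = (\<lambda>\<alpha>\<in>Fe. g \<alpha> <# \<Gamma>)" and g: "\<forall>n. poly_upto n {} 0 g"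
    using poly_map_iff[OF assms(1)] by (auto simp: poly_quot_def)
  \<comment> \<open>Points of the product space are \<open>undefined\<close> outside
    \<open>Fe\<close>, so \<open>g\<close> is replaced by its restriction, which has the same cosets
    on \<open>Fe\<close>.\<close>
  have "poly_upto n {} 0 (restrict g Fe)" for n
    by (rule poly_upto_cong_imp[of n "{}" 0 g]) (use g in auto)
  moreover have "g \<alpha> \<in> carrier G" if "\<alpha> \<in> Fe" for \<alpha>
    using poly_upto_value[of 0 "{}" 0 g \<alpha>] g that assms(2) by auto
  ultimately have "restrict g Fe \<in> polys"
    by (auto simp: polys_def)
  moreover have "y = (\<lambda>\<alpha>\<in>Fe. restrict g Fe \<alpha> <# \<Gamma>)"
    unfolding y by (rule restrict_ext) simp
  ultimately show "y \<in> (\<lambda>g. \<lambda>\<alpha>\<in>Fe. g \<alpha> <# \<Gamma>) ` polys"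
    by blast
next
  fix y assume "y \<in> (\<lambda>g. \<lambda>\<alpha>\<in>Fe. g \<alpha> <# \<Gamma>) ` polys"
  then show "y \<in> poly_quot G Gs \<Gamma>"
    using poly_map_iff[OF assms(1)] by (auto simp: poly_quot_def polys_def)
qed

end

theorem theorem2p3:
  fixes G :: "('g, 'b) monoid_scheme" and T :: "'g topology"
    and Gs :: "nat \<Rightarrow> 'g set" and \<Gamma> :: "'g set"
  assumes "topological_group G T"
    and "Hausdorff_space T"
    and "locally_compact_space T"
    and "filtration G T Gs"
    and "subgroup \<Gamma> G"
    and "subtopology T \<Gamma> = discrete_topology \<Gamma>"
    and "\<And>i. cocompact G T (Gs i) (Gs i \<inter> \<Gamma>)"
  shows "compactin (product_topology (\<lambda>_. quotient_top G T (carrier G) \<Gamma>) Fe)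
           (poly_quot G Gs \<Gamma>)"
proof -
  interpret group G
    using assms(1) by (simp add: topological_group_def)
  interpret filtered_topological_group G Gs T
    using assms(1,4) is_group
    by (intro filtered_topological_group.intro filtered_group.intro filtered_group_axioms.intro
        filtered_topological_group_axioms.intro) (auto simp: filtration_def prefiltration_def)
  obtain d where d: "Gs (Suc d) = {\<one>\<^bsub>G\<^esub>}"
    using assms(4) by (auto simp: filtration_def prefiltration_def)
  \<comment> \<open>Cocompactness enters at every level \<open>i\<close>, because correcting the
    value at a set \<beta> takes place in level card \<beta>.\<close>
  have "\<exists>C. compactin T C \<and> (\<forall>x\<in>Gs i. \<exists>c\<in>Gs i \<inter> \<Gamma>. x \<otimes>\<^bsub>G\<^esub> c \<in> C)" for i
    using assms(3,5,7) Gs_closedin Gs_subgroup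
    by (intro cocompact_imp_compact_representatives subgroups_Inter_pair) auto
  then have "compactin (product_topology (\<lambda>_. quotient_top G T (carrier G) \<Gamma>) Fe)
      ((\<lambda>g. \<lambda>\<alpha>\<in>Fe. g \<alpha> <#\<^bsub>G\<^esub> \<Gamma>) ` polys)"
    by (rule compactin_polys_quotient[OF assms(5)])
  moreover have "Gs 0 = carrier G"
    using assms(4) by (simp add: filtration_def)
  ultimately show ?thesis
    by (simp add: poly_quot_eq[OF d])
qed

end
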